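(* Let $A$ be a Noetherian integral domain of characteristic zero, and let $I_2=(2,\ a^2-a \text{ for all } a\in A)\subseteq A$ be the universal $\mathbb{F}_2$-point-detecting ideal of $A$. Then $H^0_{fl}(\mathcal{M}_{fmA}^{2\text{-}buds}; \omega^{\otimes 2})$ vanishes if and only if $I_2$ is syzygetic.
   Context: An ideal $I$ in an integral domain $A$ is called syzygetic if the multiplication map $\mathrm{Sym}_A^2(I)\to I^2$ is injective (equivalently, an isomorphism). Formal $A$-module 2-buds: for a commutative ring $A$ and commutative $A$-algebra $R$, a formal $A$-module $2$-bud over $R$ is an element $F\in R[[X,Y]]/(X,Y)^3$ satisfying the commutative formal group law axioms modulo $(X,Y)^3$, with a ring homomorphism $\rho:A\to\mathrm{End}(F)\subseteq R[[X]]/(X^3)$ (addition $F(f,g)$, multiplication composition) with $\rho(a)\equiv aX \bmod X^2$. Strict isomorphisms are isomorphisms $f\equiv X \bmod X^2$. The groupoid of these is corepresented by the graded Hopf algebroid $(L^A_{2\text{-}buds},L^A_{2\text{-}buds}B)$ described as follows. Let $\mathrm{Dr}^A$ be the $A$-module generated by symbols $\gamma$ and $c_a$ ($a\in A$), in degree $2$, subject to $(a^2-a)\gamma=2c_a$, $c_{a+b}-c_a-c_b=ab\gamma$, $ac_b+b^2c_a=c_{ab}$ for all $a,b\in A$. Then $L^A_{2\text{-}buds}=\mathrm{Sym}_A(\mathrm{Dr}^A)$, $L^A_{2\text{-}buds}B=L^A_{2\text{-}buds}[t]$ with $|t|=2$, $\eta_L(x)=x$, $\eta_R(\gamma)=\gamma+2t$,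 $\eta_R(c_a)=c_a+(a^2-a)t$, $\Delta(t)=t\otimes1+1\otimes t$, $\epsilon(t)=0$. $\mathcal{M}_{fmA}^{2\text{-}buds}$ is the Artin stack obtained by stackifying the groupoid scheme $(\mathrm{Spec}\,L^A_{2\text{-}buds},\mathrm{Spec}\,L^A_{2\text{-}buds}B)$, $\omega$ is its line bundle of invariant differentials (corresponding to the graded comodule $\Sigma^2L^A_{2\text{-}buds}$), and its flat cohomology is $H^s_{fl}(\mathcal{M}_{fmA}^{2\text{-}buds};\omega^{\otimes n})=\mathrm{Cotor}^{s,2n}_{L^A_{2\text{-}buds}B}(L^A_{2\text{-}buds},L^A_{2\text{-}buds})$, the cohomology of the cobar complex in cohomological degree $s$ and internal degree $2n$. In particular $H^0_{fl}(\mathcal{M}_{fmA}^{2\text{-}buds};\omega^{\otimes n})$ is the degree $2n$ part of $\ker(\eta_R-\eta_L)$. *)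

theory Defs
  imports "HOL-Library.Poly_Mapping" "HOL-Computational_Algebra.Polynomial"
begin

section \<open>Ideals of the base ring\<close>

text \<open>The base ring is the universe of a type of class \<^class>\<open>comm_ring_1\<close>, regarded as a module over
  itself, so that ideals are the \<^const>\<open>module.subspace\<close>s and generated ideals the
  \<^const>\<open>module.span\<close>s with respect to multiplication.\<close>

lemma module_mult: "module ((*) :: 'a::comm_ring_1 \<Rightarrow> 'a \<Rightarrow> 'a)"
  by standard (auto simp: algebra_simps)

definition is_ideal :: "'a::comm_ring_1 set \<Rightarrow> bool" where
  "is_ideal I \<longleftrightarrow> module.subspace (*) I"

definition ideal_generated :: "'a::comm_ring_1 set \<Rightarrow> 'a set" where
  "ideal_generated S = module.span (*) S"

definition noetherian :: "'a::comm_ring_1 itself \<Rightarrow> bool" where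
  "noetherian _ \<longleftrightarrow>
     (\<forall>I :: 'a set. is_ideal I \<longrightarrow> (\<exists>S. finite S \<and> I = ideal_generated S))"

definition I2 :: "'a::comm_ring_1 set" where
  "I2 = ideal_generated (insert 2 (range (\<lambda>a. a\<^sup>2 - a)))"

lemma is_ideal_I2: "is_ideal I2"
  unfolding is_ideal_def I2_def ideal_generated_def by (rule module.subspace_span[OF module_mult])


section \<open>Polynomial rings in arbitrary sets of variables\<close>

type_synonym ('x, 'a) mpol = "('x \<Rightarrow>\<^sub>0 nat) \<Rightarrow>\<^sub>0 'a"

definition mConst :: "'a::zero \<Rightarrow> ('x, 'a) mpol" where
  "mConst a = Poly_Mapping.single 0 a"

definition mVar :: "'x \<Rightarrow> ('x, 'a::zero_neq_one) mpol" where
  "mVar x = Poly_Mapping.single (Poly_Mapping.single x 1) 1"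

definition mon_degree :: "('x \<Rightarrow>\<^sub>0 nat) \<Rightarrow> nat" where
  "mon_degree m = (\<Sum>x\<in>Poly_Mapping.keys m. Poly_Mapping.lookup m x)"

definition homogeneous :: "nat \<Rightarrow> ('x, 'a::zero) mpol \<Rightarrow> bool" where
  "homogeneous n p \<longleftrightarrow> (\<forall>m\<in>Poly_Mapping.keys p. mon_degree m = n)"

definition polys_over :: "'x set \<Rightarrow> ('x, 'a::zero) mpol set" where
  "polys_over V = {p. \<forall>m\<in>Poly_Mapping.keys p. Poly_Mapping.keys m \<subseteq> V}"

text \<open>Evaluation at \<open>g\<close> of the variables, with coefficients transported along \<open>h\<close>.\<close>

definition mon_eval :: "('x \<Rightarrow> 'b::comm_ring_1) \<Rightarrow> ('x \<Rightarrow>\<^sub>0 nat) \<Rightarrow> 'b" where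
  "mon_eval g m = (\<Prod>x\<in>Poly_Mapping.keys m. g x ^ Poly_Mapping.lookup m x)"

definition mpol_eval ::
  "('a::comm_ring_1 \<Rightarrow> 'b::comm_ring_1) \<Rightarrow> ('x \<Rightarrow> 'b) \<Rightarrow> ('x, 'a) mpol \<Rightarrow> 'b" where
  "mpol_eval h g p =
     (\<Sum>m\<in>Poly_Mapping.keys p. h (Poly_Mapping.lookup p m) * mon_eval g m)"

definition is_ring_hom :: "('a::comm_ring_1 \<Rightarrow> 'b::comm_ring_1) \<Rightarrow> bool" where
  "is_ring_hom h \<longleftrightarrow>
     h 1 = 1 \<and> (\<forall>a b. h (a + b) = h a + h b) \<and> (\<forall>a b. h (a * b) = h a * h b)"

lemma is_ring_homD:
  assumes "is_ring_hom h"
  shows "h 0 = 0" "h 1 = 1" "h (a + b) = h a + h b" "h (a * b) = h a * h b"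
    "h (- a) = - h a" "h (a - b) = h a - h b"
proof -
  show *: "h 1 = 1" "h (a + b) = h a + h b" "h (a * b) = h a * h b" for a b
    using assms by (auto simp: is_ring_hom_def)
  show 0: "h 0 = 0" using *(2)[of 0 0] by simp
  show m: "h (- a) = - h a" for a using *(2)[of a "- a"] 0 by (simp add: eq_neg_iff_add_eq_0 add.commute)
  show "h (a - b) = h a - h b" using *(2)[of a "- b"] m[of b] by simp
qed

lemma mon_eval_superset:
  assumes "finite A" "Poly_Mapping.keys m \<subseteq> A"
  shows "mon_eval g m = (\<Prod>x\<in>A. g x ^ Poly_Mapping.lookup m x)"
  unfolding mon_eval_def by (rule prod.mono_neutral_left) (use assms in \<open>auto simp: in_keys_iff\<close>)

lemma mon_eval_add: "mon_eval g (m + n) = mon_eval g m * mon_eval g n"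
proof -
  let ?A = "Poly_Mapping.keys m \<union> Poly_Mapping.keys n"
  have "mon_eval g k = (\<Prod>x\<in>?A. g x ^ Poly_Mapping.lookup k x)" if "k \<in> {m, n, m + n}" for k
    by (rule mon_eval_superset) (use that keys_add[of m n] in auto)
  then show ?thesis by (simp add: lookup_add power_add prod.distrib)
qed

lemma mon_eval_0 [simp]: "mon_eval g 0 = 1"
  by (simp add: mon_eval_def)

lemma mpol_eval_superset:
  assumes "is_ring_hom h" "finite A" "Poly_Mapping.keys p \<subseteq> A"
  shows "mpol_eval h g p = (\<Sum>m\<in>A. h (Poly_Mapping.lookup p m) * mon_eval g m)"
  unfolding mpol_eval_def
  by (rule sum.mono_neutral_left) (use assms in \<open>auto simp: in_keys_iff is_ring_homD\<close>)

lemma mpol_eval_add: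
  assumes "is_ring_hom h"
  shows "mpol_eval h g (p + q) = mpol_eval h g p + mpol_eval h g q"
proof -
  let ?A = "Poly_Mapping.keys p \<union> Poly_Mapping.keys q"
  have "mpol_eval h g r = (\<Sum>m\<in>?A. h (Poly_Mapping.lookup r m) * mon_eval g m)"
    if "r \<in> {p, q, p + q}" for r
    by (rule mpol_eval_superset[OF assms]) (use that keys_add[of p q] in auto)
  then show ?thesis by (simp add: lookup_add is_ring_homD[OF assms] distrib_right sum.distrib)
qed

lemma mpol_eval_0 [simp]: "mpol_eval h g 0 = 0"
  by (simp add: mpol_eval_def)

lemma mpol_eval_single:
  assumes "is_ring_hom h"
  shows "mpol_eval h g (Poly_Mapping.single m a) = h a * mon_eval g m"
  by (subst mpol_eval_superset[OF assms, of "{m}"]) auto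

lemma mpol_eval_const: "is_ring_hom h \<Longrightarrow> mpol_eval h g (mConst a) = h a"
  by (simp add: mConst_def mpol_eval_single)

lemma mpol_eval_var: "is_ring_hom h \<Longrightarrow> mpol_eval h g (mVar x) = g x"
  by (simp add: mVar_def mpol_eval_single is_ring_homD mon_eval_def)

lemma mpol_induct [case_names zero single add]:
  assumes "P 0" "\<And>m a. P (Poly_Mapping.single m a)" "\<And>p q. P p \<Longrightarrow> P q \<Longrightarrow> P (p + q)"
  shows "P (p :: 'k \<Rightarrow>\<^sub>0 'a::comm_monoid_add)"
proof -
  have "p = (\<Sum>m\<in>Poly_Mapping.keys p. Poly_Mapping.single m (Poly_Mapping.lookup p m))"
    by (rule poly_mapping_eqI)
      (auto simp: lookup_sum lookup_single when_def in_keys_iff)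
  moreover have "P (\<Sum>m\<in>A. Poly_Mapping.single m (Poly_Mapping.lookup p m))" if "finite A" for A
    using that by induction (auto intro: assms)
  ultimately show ?thesis by (metis finite_keys)
qed

lemma mpol_eval_mult:
  assumes "is_ring_hom h"
  shows "mpol_eval h g (p * q) = mpol_eval h g p * mpol_eval h g q"
proof (induction p rule: mpol_induct)
  case (single m a)
  show ?case
    by (induction q rule: mpol_induct)
      (auto simp: mult_single mpol_eval_single[OF assms] is_ring_homD[OF assms] mon_eval_add
        mpol_eval_add[OF assms] algebra_simps)
qed (auto simp: mpol_eval_add[OF assms] algebra_simps)

lemma is_ring_hom_mpol_eval:
  assumes "is_ring_hom h" shows "is_ring_hom (mpol_eval h g)"
  using mpol_eval_const[OF assms, of g 1]
  by (simp add: is_ring_hom_def mpol_eval_add mpol_eval_mult assms is_ring_homD[OF assms]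
      mConst_def)


section \<open>Symmetric algebras\<close>

text \<open>The symmetric algebra of a module \<open>M\<close>, given as a submodule of a type with scalar multiplication
  \<open>scale\<close>, is the polynomial ring on one variable per element of \<open>M\<close> modulo the ideal which makes
  the insertion of \<open>M\<close> linear. This ideal is formed inside the ring \<^term>\<open>polys_over M\<close>.\<close>

definition sym_relators :: "('a::comm_ring_1 \<Rightarrow> 'm::ab_group_add \<Rightarrow> 'm) \<Rightarrow> 'm set \<Rightarrow> ('m, 'a) mpol set"
  where "sym_relators scale M =
     {mVar (x + y) - mVar x - mVar y | x y. x \<in> M \<and> y \<in> M} \<union>
     {mVar (scale a x) - mConst a * mVar x | a x. x \<in> M}"

definition sym_ideal :: "('a::comm_ring_1 \<Rightarrow> 'm::ab_group_add \<Rightarrow> 'm) \<Rightarrow> 'm set \<Rightarrow> ('m, 'a) mpol set"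
  where "sym_ideal scale M =
     {\<Sum>r\<in>T. q r * r | q T. finite T \<and> T \<subseteq> sym_relators scale M \<and> (\<forall>r\<in>T. q r \<in> polys_over M)}"

definition sym_class ::
  "('a::comm_ring_1 \<Rightarrow> 'm::ab_group_add \<Rightarrow> 'm) \<Rightarrow> 'm set \<Rightarrow> ('m, 'a) mpol \<Rightarrow> ('m, 'a) mpol set"
  where "sym_class scale M p = {q \<in> polys_over M. q - p \<in> sym_ideal scale M}"

definition sym_power ::
  "('a::comm_ring_1 \<Rightarrow> 'm::ab_group_add \<Rightarrow> 'm) \<Rightarrow> 'm set \<Rightarrow> nat \<Rightarrow> ('m, 'a) mpol set set"
  where "sym_power scale M n = sym_class scale M ` {p \<in> polys_over M. homogeneous n p}"

lemma sym_ideal_mpol_eval: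
  assumes h: "is_ring_hom h"
    and "\<And>x y. x \<in> M \<Longrightarrow> y \<in> M \<Longrightarrow> g (x + y) = g x + g y"
    and "\<And>a x. x \<in> M \<Longrightarrow> g (scale a x) = h a * g x"
    and "p \<in> sym_ideal scale M"
  shows "mpol_eval h g p = 0"
proof -
  note hom = is_ring_homD[OF is_ring_hom_mpol_eval[OF h, of g]]
  from assms obtain q T where p: "p = (\<Sum>r\<in>T. q r * r)" "finite T" "T \<subseteq> sym_relators scale M"
    by (auto simp: sym_ideal_def)
  have r: "mpol_eval h g r = 0" if "r \<in> sym_relators scale M" for r
    using that assms by (auto simp: sym_relators_def hom mpol_eval_var mpol_eval_const)
  from p(2,3) have "mpol_eval h g (\<Sum>r\<in>T. q r * r) = 0"
    by induction (auto simp: hom r)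
  then show ?thesis by (simp add: p)
qed

lemma zero_in_sym_ideal: "0 \<in> sym_ideal scale M"
  unfolding sym_ideal_def by (auto intro!: exI[of _ "{}"])

lemma zero_in_polys_over: "0 \<in> polys_over M"
  by (simp add: polys_over_def)

lemma uminus_in_polys_over:
  fixes p :: "('x, 'a::ab_group_add) mpol"
  assumes "p \<in> polys_over M" shows "- p \<in> polys_over M"
  using assms by (auto simp: polys_over_def in_keys_iff)

lemma add_in_polys_over:
  fixes p :: "('x, 'a::ab_group_add) mpol"
  assumes "p \<in> polys_over M" "q \<in> polys_over M" shows "p + q \<in> polys_over M"
  using assms keys_add[of p q] unfolding polys_over_def by blast

lemma mult_in_polys_over:
  fixes p :: "('x, 'a::comm_ring_1) mpol"
  assumes "p \<in> polys_over M" "q \<in> polys_over M" shows "p * q \<in> polys_over M"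
proof -
  have "Poly_Mapping.keys m \<subseteq> M" if m: "m \<in> Poly_Mapping.keys (p * q)" for m
  proof -
    obtain a b where ab: "m = a + b" "a \<in> Poly_Mapping.keys p" "b \<in> Poly_Mapping.keys q"
      using keys_mult[of p q] m by blast
    then show ?thesis using keys_add[of a b] assms unfolding polys_over_def by blast
  qed
  then show ?thesis by (simp add: polys_over_def)
qed

lemma sym_ideal_add:
  assumes "p \<in> sym_ideal scale M" "q \<in> sym_ideal scale M"
  shows "p + q \<in> sym_ideal scale M"
proof -
  from assms obtain f T g U where
    p: "p = (\<Sum>r\<in>T. f r * r)" "finite T" "T \<subseteq> sym_relators scale M" "\<forall>r\<in>T. f r \<in> polys_over M" and
    q: "q = (\<Sum>r\<in>U. g r * r)" "finite U" "U \<subseteq> sym_relators scale M" "\<forall>r\<in>U. g r \<in> polys_over M"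
    unfolding sym_ideal_def by blast
  define k where "k r = (if r \<in> T then f r else 0) + (if r \<in> U then g r else 0)" for r
  have "p = (\<Sum>r\<in>T \<union> U. (if r \<in> T then f r else 0) * r)"
    unfolding p by (rule sum.mono_neutral_cong_left) (use p q in auto)
  moreover have "q = (\<Sum>r\<in>T \<union> U. (if r \<in> U then g r else 0) * r)"
    unfolding q by (rule sum.mono_neutral_cong_left) (use p q in auto)
  ultimately have "p + q = (\<Sum>r\<in>T \<union> U. k r * r)"
    by (simp add: k_def distrib_right sum.distrib)
  moreover have "\<forall>r\<in>T \<union> U. k r \<in> polys_over M"
    using p q by (auto simp: k_def intro!: add_in_polys_over zero_in_polys_over)
  ultimately show ?thesis
    unfolding sym_ideal_def using p q
    by (intro CollectI exI[of _ k] exI[of _ "T \<union> U"]) auto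
qed

lemma sym_ideal_mult:
  assumes "p \<in> sym_ideal scale M" "c \<in> polys_over M"
  shows "c * p \<in> sym_ideal scale M"
proof -
  from assms obtain f T where
    p: "p = (\<Sum>r\<in>T. f r * r)" "finite T" "T \<subseteq> sym_relators scale M" "\<forall>r\<in>T. f r \<in> polys_over M"
    unfolding sym_ideal_def by blast
  then have "c * p = (\<Sum>r\<in>T. (c * f r) * r)"
    by (simp add: sum_distrib_left mult.assoc)
  then show ?thesis
    unfolding sym_ideal_def using p assms(2)
    by (intro CollectI exI[of _ "\<lambda>r. c * f r"] exI[of _ T]) (auto intro: mult_in_polys_over)
qed

lemma sym_ideal_uminus:
  assumes "p \<in> sym_ideal scale M" shows "- p \<in> sym_ideal scale M"
proof -
  have "(1 :: ('a, 'b) mpol) \<in> polys_over M" by (simp add: polys_over_def)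
  from sym_ideal_mult[OF assms uminus_in_polys_over[OF this]] show ?thesis by simp
qed

lemma sym_relators_in_sym_ideal:
  assumes "r \<in> sym_relators scale M" shows "r \<in> sym_ideal scale M"
  unfolding sym_ideal_def using assms
  by (intro CollectI exI[of _ "\<lambda>_. 1"] exI[of _ "{r}"]) (auto simp: polys_over_def)


section \<open>Syzygetic ideals\<close>

text \<open>The multiplication map sends the class of a polynomial in elements of \<open>I\<close> to its value.\<close>

definition sym_mult_map :: "('a, 'a::comm_ring_1) mpol set \<Rightarrow> 'a" where
  "sym_mult_map C = the_elem (mpol_eval (\<lambda>a. a) (\<lambda>x. x) ` C)"

definition syzygetic :: "'a::comm_ring_1 set \<Rightarrow> bool" where
  "syzygetic I \<longleftrightarrow> inj_on sym_mult_map (sym_power (*) I 2)"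

lemma is_ring_hom_id: "is_ring_hom (\<lambda>a. a)"
  by (simp add: is_ring_hom_def)

lemma sym_mult_map_class:
  assumes "p \<in> polys_over I"
  shows "sym_mult_map (sym_class (*) I p) = mpol_eval (\<lambda>a. a) (\<lambda>x. x) p"
proof -
  have "p \<in> sym_class (*) I p"
    using assms by (simp add: sym_class_def zero_in_sym_ideal)
  moreover have "mpol_eval (\<lambda>a. a) (\<lambda>x. x) q = mpol_eval (\<lambda>a. a) (\<lambda>x. x) p"
    if "q \<in> sym_class (*) I p" for q
    using sym_ideal_mpol_eval[OF is_ring_hom_id, of I "\<lambda>x. x" "(*)" "q - p"] that
    by (simp add: sym_class_def is_ring_homD[OF is_ring_hom_mpol_eval[OF is_ring_hom_id]])
  ultimately have "mpol_eval (\<lambda>a. a) (\<lambda>x. x) ` sym_class (*) I p = {mpol_eval (\<lambda>a. a) (\<lambda>x. x) p}"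
    by blast
  then show ?thesis by (simp add: sym_mult_map_def)
qed


section \<open>The module of indecomposables\<close>

datatype 'a dr_symbol = Gamma | C 'a

definition fscale :: "'a::comm_ring_1 \<Rightarrow> ('x \<Rightarrow>\<^sub>0 'a) \<Rightarrow> ('x \<Rightarrow>\<^sub>0 'a)" where
  "fscale a f = Poly_Mapping.map ((*) a) f"

lemma lookup_fscale [simp]: "Poly_Mapping.lookup (fscale a f) x = a * Poly_Mapping.lookup f x"
  by (simp add: fscale_def Poly_Mapping.map.rep_eq when_def)

lemma module_fscale: "module fscale"
  by standard (auto intro!: poly_mapping_eqI simp: lookup_add algebra_simps)

abbreviation sym_Gamma :: "'a::comm_ring_1 dr_symbol \<Rightarrow>\<^sub>0 'a" where
  "sym_Gamma \<equiv> Poly_Mapping.single Gamma 1"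

abbreviation sym_C :: "'a::comm_ring_1 \<Rightarrow> 'a dr_symbol \<Rightarrow>\<^sub>0 'a" where
  "sym_C a \<equiv> Poly_Mapping.single (C a) 1"

definition dr_relators :: "('a::comm_ring_1 dr_symbol \<Rightarrow>\<^sub>0 'a) set" where
  "dr_relators =
     {fscale (a\<^sup>2 - a) sym_Gamma - fscale 2 (sym_C a) | a. True} \<union>
     {sym_C (a + b) - sym_C a - sym_C b - fscale (a * b) sym_Gamma | a b. True} \<union>
     {fscale a (sym_C b) + fscale (b\<^sup>2) (sym_C a) - sym_C (a * b) | a b. True}"

definition dr_submodule :: "('a::comm_ring_1 dr_symbol \<Rightarrow>\<^sub>0 'a) set" where
  "dr_submodule = module.span fscale dr_relators"

definition dr_cong :: "('a::comm_ring_1 dr_symbol \<Rightarrow>\<^sub>0 'a) \<Rightarrow> ('a dr_symbol \<Rightarrow>\<^sub>0 'a) \<Rightarrow> bool" where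
  "dr_cong f g \<longleftrightarrow> f - g \<in> dr_submodule"

lemma dr_submodule:
  "0 \<in> dr_submodule"
  "f \<in> dr_submodule \<Longrightarrow> g \<in> dr_submodule \<Longrightarrow> f + g \<in> dr_submodule"
  "f \<in> dr_submodule \<Longrightarrow> fscale a f \<in> dr_submodule"
  "f \<in> dr_submodule \<Longrightarrow> - f \<in> dr_submodule"
  "f \<in> dr_relators \<Longrightarrow> f \<in> dr_submodule"
  unfolding dr_submodule_def
  by (auto intro: module.span_zero[OF module_fscale] module.span_add[OF module_fscale]
      module.span_scale[OF module_fscale] module.span_neg[OF module_fscale]
      module.span_base[OF module_fscale])

lemma fscale_uminus: "fscale a (- f) = - fscale a f"
  by (intro poly_mapping_eqI) simp

lemma fscale_add: "fscale a (f + g) = fscale a f + fscale a g"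
  by (intro poly_mapping_eqI) (simp add: lookup_add algebra_simps)

lemma fscale_diff: "fscale a (f - g) = fscale a f - fscale a g"
  by (intro poly_mapping_eqI) (simp add: lookup_minus algebra_simps)

quotient_type (overloaded) 'a dr = "'a::comm_ring_1 dr_symbol \<Rightarrow>\<^sub>0 'a" / dr_cong
proof (rule equivpI)
  show "reflp dr_cong" by (auto intro: reflpI simp: dr_cong_def dr_submodule)
  show "symp dr_cong"
    by (rule sympI) (use dr_submodule(4) in \<open>fastforce simp: dr_cong_def\<close>)
  show "transp dr_cong"
    by (rule transpI) (use dr_submodule(2) in \<open>fastforce simp: dr_cong_def\<close>)
qed

instantiation dr :: (comm_ring_1) ab_group_add
begin

lift_definition zero_dr :: "'a dr" is 0 .

lift_definition plus_dr :: "'a dr \<Rightarrow> 'a dr \<Rightarrow> 'a dr" is "(+)"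
  unfolding dr_cong_def by (metis add_diff_add dr_submodule(2))

lift_definition uminus_dr :: "'a dr \<Rightarrow> 'a dr" is uminus
  unfolding dr_cong_def by (metis minus_diff_minus dr_submodule(4))

lift_definition minus_dr :: "'a dr \<Rightarrow> 'a dr \<Rightarrow> 'a dr" is "(-)"
  unfolding dr_cong_def
  by (metis (no_types, lifting) add_diff_add diff_conv_add_uminus dr_submodule(2,4) minus_diff_minus)

instance
  by standard (transfer; simp add: dr_cong_def dr_submodule algebra_simps)+

end

lift_definition dr_scale :: "'a::comm_ring_1 \<Rightarrow> 'a dr \<Rightarrow> 'a dr" is fscale
  unfolding dr_cong_def by (metis fscale_diff dr_submodule(3))

lift_definition dr_gamma :: "'a::comm_ring_1 dr" is sym_Gamma .

lift_definition dr_c :: "'a::comm_ring_1 \<Rightarrow> 'a dr" is sym_C .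

lemma module_dr_scale: "module dr_scale"
  by standard
    (transfer; simp add: dr_cong_def dr_submodule(1) module.scale_right_distrib[OF module_fscale]
        module.scale_left_distrib[OF module_fscale] module.scale_scale[OF module_fscale]
        module.scale_one[OF module_fscale])+

lemma dr_relation_gamma: "dr_scale (a\<^sup>2 - a) dr_gamma = dr_scale 2 (dr_c a)"
  unfolding dr_gamma.abs_eq dr_c.abs_eq dr_scale.abs_eq plus_dr.abs_eq minus_dr.abs_eq
    dr.abs_eq_iff dr_cong_def
  by (rule dr_submodule(5)) (unfold dr_relators_def, blast)

lemma dr_relation_add: "dr_c (a + b) - dr_c a - dr_c b = dr_scale (a * b) dr_gamma"
  unfolding dr_gamma.abs_eq dr_c.abs_eq dr_scale.abs_eq plus_dr.abs_eq minus_dr.abs_eq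
    dr.abs_eq_iff dr_cong_def
  by (rule dr_submodule(5)) (unfold dr_relators_def, blast)

lemma dr_relation_mult: "dr_scale a (dr_c b) + dr_scale (b\<^sup>2) (dr_c a) = dr_c (a * b)"
  unfolding dr_gamma.abs_eq dr_c.abs_eq dr_scale.abs_eq plus_dr.abs_eq minus_dr.abs_eq
    dr.abs_eq_iff dr_cong_def
  by (rule dr_submodule(5)) (unfold dr_relators_def, blast)

text \<open>The linear form with \<open>\<gamma> \<mapsto> 2\<close> and \<open>c\<^sub>a \<mapsto> a\<^sup>2 - a\<close>: the right unit of the Hopf algebroid adds to
  each element of the module its value under this form times \<open>t\<close>.\<close>

definition symbol_shift :: "'a::comm_ring_1 dr_symbol \<Rightarrow> 'a" where
  "symbol_shift s = (case s of Gamma \<Rightarrow> 2 | C a \<Rightarrow> a\<^sup>2 - a)"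

definition free_shift :: "('a::comm_ring_1 dr_symbol \<Rightarrow>\<^sub>0 'a) \<Rightarrow> 'a" where
  "free_shift f =
     (\<Sum>s\<in>Poly_Mapping.keys f. Poly_Mapping.lookup f s * symbol_shift s)"

lemma free_shift_superset:
  assumes "finite A" "Poly_Mapping.keys f \<subseteq> A"
  shows "free_shift f = (\<Sum>s\<in>A. Poly_Mapping.lookup f s * symbol_shift s)"
  unfolding free_shift_def
  by (rule sum.mono_neutral_left) (use assms in \<open>auto simp: in_keys_iff\<close>)

lemma free_shift_add: "free_shift (f + g) = free_shift f + free_shift g"
proof -
  let ?A = "Poly_Mapping.keys f \<union> Poly_Mapping.keys g"
  have "free_shift k = (\<Sum>s\<in>?A. Poly_Mapping.lookup k s * symbol_shift s)"
    if "k \<in> {f, g, f + g}" for k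
    by (rule free_shift_superset) (use that keys_add[of f g] in auto)
  then show ?thesis by (simp add: lookup_add distrib_right sum.distrib)
qed

lemma free_shift_fscale: "free_shift (fscale a f) = a * free_shift f"
proof -
  have "Poly_Mapping.keys (fscale a f) \<subseteq> Poly_Mapping.keys f"
    by (auto simp: in_keys_iff)
  then have "free_shift (fscale a f) =
      (\<Sum>s\<in>Poly_Mapping.keys f. Poly_Mapping.lookup (fscale a f) s * symbol_shift s)"
    by (intro free_shift_superset) auto
  then show ?thesis by (simp add: free_shift_def sum_distrib_left mult.assoc)
qed

lemma free_shift_single: "free_shift (Poly_Mapping.single s a) = a * symbol_shift s"
  by (subst free_shift_superset[of "{s}"]) auto

lemma free_shift_uminus: "free_shift (- f) = - free_shift f"
  using free_shift_add[of f "- f"] by (simp add: free_shift_def eq_neg_iff_add_eq_0 add.commute)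

lemma free_shift_diff: "free_shift (f - g) = free_shift f - free_shift g"
  using free_shift_add[of f "- g"] by (simp add: free_shift_uminus)

lemma free_shift_relators: "f \<in> dr_relators \<Longrightarrow> free_shift f = 0"
  unfolding dr_relators_def
  by (elim UnE CollectE exE conjE, hypsubst,
      simp_all only: free_shift_add free_shift_diff free_shift_fscale free_shift_single)
    (simp_all add: symbol_shift_def power2_eq_square algebra_simps)

lemma free_shift_submodule:
  assumes "f \<in> dr_submodule" shows "free_shift f = 0"
  using assms unfolding dr_submodule_def
proof (induction rule: module.span_induct_alt[OF module_fscale, consumes 1])
  case 1
  show ?case by (simp add: free_shift_def)
next
  case (2 a x y)
  then show ?case by (simp add: free_shift_add free_shift_fscale free_shift_relators)
qed

lift_definition dr_shift :: "'a::comm_ring_1 dr \<Rightarrow> 'a" is free_shift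
  unfolding dr_cong_def by (drule free_shift_submodule) (simp add: free_shift_diff)

lemma dr_shift_gamma: "dr_shift dr_gamma = 2"
  by transfer (simp add: free_shift_single symbol_shift_def)

lemma dr_shift_c: "dr_shift (dr_c a) = a\<^sup>2 - a"
  by transfer (simp add: free_shift_single symbol_shift_def)

lemma dr_shift_add: "dr_shift (x + y) = dr_shift x + dr_shift y"
  by transfer (simp add: free_shift_add)

lemma dr_shift_scale: "dr_shift (dr_scale a x) = a * dr_shift x"
  by transfer (simp add: free_shift_fscale)


section \<open>The Hopf algebroid of formal module 2-buds\<close>

text \<open>The ring of objects is the symmetric algebra of the module above; the ring of morphisms is the
  polynomial ring over it in \<open>t\<close>, i.e. the type \<open>'a bud_ring poly\<close>.\<close>

definition bud_cong :: "('a::comm_ring_1 dr, 'a) mpol \<Rightarrow> ('a dr, 'a) mpol \<Rightarrow> bool" where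
  "bud_cong p q \<longleftrightarrow> p - q \<in> sym_ideal dr_scale UNIV"

lemma polys_over_UNIV [simp]: "polys_over UNIV = UNIV"
  by (simp add: polys_over_def)

quotient_type (overloaded) 'a bud_ring = "('a::comm_ring_1 dr, 'a) mpol" / bud_cong
proof (rule equivpI)
  show "reflp bud_cong" by (auto intro: reflpI simp: bud_cong_def zero_in_sym_ideal)
  show "symp bud_cong"
    by (rule sympI) (use sym_ideal_uminus in \<open>fastforce simp: bud_cong_def\<close>)
  show "transp bud_cong"
    by (rule transpI) (use sym_ideal_add in \<open>fastforce simp: bud_cong_def\<close>)
qed

lemma one_notin_sym_ideal: "(1 :: ('a::comm_ring_1 dr, 'a) mpol) \<notin> sym_ideal dr_scale UNIV"
proof
  assume "(1 :: ('a dr, 'a) mpol) \<in> sym_ideal dr_scale UNIV"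
  from sym_ideal_mpol_eval[OF is_ring_hom_id _ _ this, of "\<lambda>_. 0"]
  show False by (simp add: is_ring_homD[OF is_ring_hom_mpol_eval[OF is_ring_hom_id]])
qed

lemma bud_cong_eqI: "p = q \<Longrightarrow> bud_cong p q"
  by (simp add: bud_cong_def zero_in_sym_ideal)

instantiation bud_ring :: (comm_ring_1) comm_ring_1
begin

lift_definition zero_bud_ring :: "'a bud_ring" is 0 .

lift_definition one_bud_ring :: "'a bud_ring" is 1 .

lift_definition plus_bud_ring :: "'a bud_ring \<Rightarrow> 'a bud_ring \<Rightarrow> 'a bud_ring" is "(+)"
  unfolding bud_cong_def by (metis add_diff_add sym_ideal_add)

lift_definition uminus_bud_ring :: "'a bud_ring \<Rightarrow> 'a bud_ring" is uminus
  unfolding bud_cong_def by (metis minus_diff_minus sym_ideal_uminus)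

lift_definition minus_bud_ring :: "'a bud_ring \<Rightarrow> 'a bud_ring \<Rightarrow> 'a bud_ring" is "(-)"
  unfolding bud_cong_def
  by (metis (no_types, lifting) add_diff_add diff_conv_add_uminus sym_ideal_add sym_ideal_uminus
      minus_diff_minus)

lift_definition times_bud_ring :: "'a bud_ring \<Rightarrow> 'a bud_ring \<Rightarrow> 'a bud_ring" is "(*)"
proof -
  fix p p' q q' :: "('a dr, 'a) mpol"
  assume "bud_cong p p'" "bud_cong q q'"
  then have "q * (p - p') + p' * (q - q') \<in> sym_ideal dr_scale UNIV"
    unfolding bud_cong_def by (intro sym_ideal_add sym_ideal_mult) auto
  then show "bud_cong (p * q) (p' * q')"
    by (simp add: bud_cong_def algebra_simps)
qed

instance
proof
  show "(0 :: 'a bud_ring) \<noteq> 1"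
    unfolding zero_bud_ring.abs_eq one_bud_ring.abs_eq bud_ring.abs_eq_iff bud_cong_def
    using sym_ideal_uminus[of "- 1"] one_notin_sym_ideal by auto
qed (transfer; rule bud_cong_eqI; simp add: algebra_simps)+

end

lift_definition bud_const :: "'a::comm_ring_1 \<Rightarrow> 'a bud_ring" is mConst .

definition bud_of_dr :: "'a::comm_ring_1 dr \<Rightarrow> 'a bud_ring" where
  "bud_of_dr x = abs_bud_ring (mVar x)"

lemma is_ring_hom_bud_const: "is_ring_hom bud_const"
  unfolding is_ring_hom_def
  by (intro conjI allI; transfer)
    (simp_all add: bud_cong_def mConst_def single_add mult_single zero_in_sym_ideal)

lemma bud_of_dr_add: "bud_of_dr (x + y) = bud_of_dr x + bud_of_dr y"
proof -
  have "mVar (x + y) - mVar x - mVar y \<in> sym_ideal dr_scale UNIV"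
    by (rule sym_relators_in_sym_ideal) (auto simp: sym_relators_def)
  then show ?thesis
    by (simp add: bud_of_dr_def plus_bud_ring.abs_eq bud_ring.abs_eq_iff bud_cong_def algebra_simps)
qed

lemma bud_of_dr_scale: "bud_of_dr (dr_scale a x) = bud_const a * bud_of_dr x"
proof -
  have "mVar (dr_scale a x) - mConst a * mVar x \<in> sym_ideal dr_scale UNIV"
    by (rule sym_relators_in_sym_ideal) (auto simp: sym_relators_def)
  then show ?thesis
    by (simp add: bud_of_dr_def bud_const.abs_eq times_bud_ring.abs_eq bud_ring.abs_eq_iff
        bud_cong_def)
qed

definition eta_L :: "'a::comm_ring_1 bud_ring \<Rightarrow> 'a bud_ring poly" where
  "eta_L x = [:x:]"

text \<open>The right unit is the homomorphism of algebras extending \<open>x \<mapsto> x + dr_shift x \<cdot> t\<close> on the module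
  of generators; its characterization on \<open>\<gamma>\<close> and \<open>c\<^sub>a\<close> is verified below.\<close>

definition eta_R_mpol :: "('a::comm_ring_1 dr, 'a) mpol \<Rightarrow> 'a bud_ring poly" where
  "eta_R_mpol =
     mpol_eval (\<lambda>a. [:bud_const a:]) (\<lambda>x. [:bud_of_dr x, bud_const (dr_shift x):])"

definition eta_R :: "'a::comm_ring_1 bud_ring \<Rightarrow> 'a bud_ring poly" where
  "eta_R x = eta_R_mpol (rep_bud_ring x)"

lemma is_ring_hom_bud_const_poly: "is_ring_hom (\<lambda>a. [:bud_const a:])"
  by (simp add: is_ring_hom_def is_ring_homD[OF is_ring_hom_bud_const] one_pCons)

lemma is_ring_hom_eta_R_mpol: "is_ring_hom eta_R_mpol"
  unfolding eta_R_mpol_def by (rule is_ring_hom_mpol_eval[OF is_ring_hom_bud_const_poly])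

lemma eta_R_mpol_sym_ideal:
  assumes "p \<in> sym_ideal dr_scale UNIV" shows "eta_R_mpol p = 0"
  unfolding eta_R_mpol_def
  by (rule sym_ideal_mpol_eval[OF is_ring_hom_bud_const_poly _ _ assms])
    (simp_all add: bud_of_dr_add bud_of_dr_scale dr_shift_add dr_shift_scale
      is_ring_homD[OF is_ring_hom_bud_const])

lemma eta_R_abs: "eta_R (abs_bud_ring p) = eta_R_mpol p"
proof -
  have "bud_cong (rep_bud_ring (abs_bud_ring p)) p"
    by (simp add: Quotient3_abs_rep[OF Quotient3_bud_ring] flip: bud_ring.abs_eq_iff)
  then have "eta_R_mpol (rep_bud_ring (abs_bud_ring p) - p) = 0"
    by (simp add: bud_cong_def eta_R_mpol_sym_ideal)
  then show ?thesis
    by (simp add: eta_R_def is_ring_homD[OF is_ring_hom_eta_R_mpol])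
qed

lemma is_ring_hom_eta_R: "is_ring_hom eta_R"
proof -
  have "eta_R (x + y) = eta_R x + eta_R y \<and> eta_R (x * y) = eta_R x * eta_R y"
    for x y :: "'a bud_ring"
  proof -
    obtain p q where x: "x = abs_bud_ring p" and y: "y = abs_bud_ring q"
      by (metis Quotient3_abs_rep[OF Quotient3_bud_ring])
    show ?thesis
      unfolding x y plus_bud_ring.abs_eq times_bud_ring.abs_eq eta_R_abs
      using is_ring_homD(3,4)[OF is_ring_hom_eta_R_mpol] by blast
  qed
  moreover have "eta_R 1 = (1 :: 'a bud_ring poly)"
    by (simp add: one_bud_ring.abs_eq eta_R_abs is_ring_homD[OF is_ring_hom_eta_R_mpol])
  ultimately show ?thesis by (simp add: is_ring_hom_def)
qed

lemma eta_R_const: "eta_R (bud_const a) = [:bud_const a:]"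
proof -
  have "eta_R (bud_const a) = eta_R_mpol (mConst a)" by (simp add: bud_const.abs_eq eta_R_abs)
  then show ?thesis by (simp add: eta_R_mpol_def mpol_eval_const[OF is_ring_hom_bud_const_poly])
qed

lemma eta_R_of_dr: "eta_R (bud_of_dr x) = [:bud_of_dr x, bud_const (dr_shift x):]"
  unfolding bud_of_dr_def[of x] eta_R_abs eta_R_mpol_def
  by (simp add: mpol_eval_var[OF is_ring_hom_bud_const_poly] bud_of_dr_def)

lemma eta_R_gamma: "eta_R (bud_of_dr dr_gamma) = [:bud_of_dr dr_gamma:] + 2 * [:0, 1:]"
proof -
  have "bud_const (1 + 1) = (1 + 1 :: 'a bud_ring)"
    by (simp only: is_ring_homD[OF is_ring_hom_bud_const])
  then have "bud_const 2 = (2 :: 'a bud_ring)" by simp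
  then show ?thesis by (simp add: eta_R_of_dr dr_shift_gamma numeral_poly)
qed

lemma eta_R_c: "eta_R (bud_of_dr (dr_c a)) = [:bud_of_dr (dr_c a):] + [:bud_const (a\<^sup>2 - a):] * [:0, 1:]"
  by (simp add: eta_R_of_dr dr_shift_c)


section \<open>Cohomology in degree zero\<close>

text \<open>The generators of the bud ring have internal degree 2.\<close>

definition bud_degree_part :: "nat \<Rightarrow> 'a::comm_ring_1 bud_ring set" where
  "bud_degree_part d =
     abs_bud_ring ` {p. \<forall>m\<in>Poly_Mapping.keys p. 2 * mon_degree m = d}"

text \<open>The first differential of the cobar complex is \<open>\<eta>\<^sub>R - \<eta>\<^sub>L\<close>, and the flat cohomology
  of the stack of formal module 2-buds with coefficients in \<open>\<omega>\<^sup>n\<close> is the cohomology of this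
  complex in internal degree \<open>2n\<close>.\<close>

definition cobar_d0 :: "'a::comm_ring_1 bud_ring \<Rightarrow> 'a bud_ring poly" where
  "cobar_d0 x = eta_R x - eta_L x"

definition H0_fl_buds :: "nat \<Rightarrow> 'a::comm_ring_1 bud_ring set" where
  "H0_fl_buds n = {x \<in> bud_degree_part (2 * n). cobar_d0 x = 0}"

end

theory Submission
  imports Defs
begin

text \<open>The module of generators is always isomorphic to \<open>I\<^sub>2\<close>, by the form \<open>s\<close> with \<open>s(\<gamma>) = 2\<close> and
  \<open>s(c\<^sub>a) = a\<^sup>2 - a\<close>. Indeed the relations give \<open>s(y) x = s(x) y\<close>, and from this one
  checks \<open>c\<^bsub>s(x)\<^esub> = (s(x) - 1) x\<close> on generators and under linear combinations; as \<open>c\<^sub>0 = 0\<close>, an element with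
  \<open>s(x) = 0\<close> vanishes. On a product of two generators,
  \<open>\<eta>\<^sub>R(xy) - \<eta>\<^sub>L(xy) = (s(y) x + s(x) y) t + s(x) s(y) t\<^sup>2 = s(x) s(y) (\<gamma> t + t\<^sup>2)\<close>,
  since \<open>2 s(x) y = s(x) s(y) \<gamma>\<close>. So in degree 4 the kernel of \<open>\<eta>\<^sub>R - \<eta>\<^sub>L\<close> is the kernel of the
  multiplication map on the symmetric square of \<open>I\<^sub>2\<close>.\<close>

section \<open>The module of generators and its identification with the ideal
  \<open>I2\<close>\<close>

interpretation dr: module dr_scale
  by (rule module_dr_scale)

text \<open>Representatives are finite sums of scaled symbols. The generator cases carry a scalar,
  so that the rule also applies to properties that are not visibly stable under scaling, such as
  \<open>dr_c_shift\<close>.\<close>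

lemma dr_induct [case_names zero gamma c add]:
  assumes "P 0" "\<And>a. P (dr_scale a dr_gamma)" "\<And>a b. P (dr_scale a (dr_c b))"
    and "\<And>x y. P x \<Longrightarrow> P y \<Longrightarrow> P (x + y)"
  shows "P x"
proof -
  have "P (abs_dr f)" for f
  proof (induction f rule: mpol_induct)
    case zero
    then show ?case using assms(1) by (simp add: zero_dr_def)
  next
    case (single s a)
    have "Poly_Mapping.single s a = fscale a (Poly_Mapping.single s 1)"
      by (rule poly_mapping_eqI) (simp add: lookup_single when_def)
    then show ?case
      using assms(2)[of a] assms(3)[of a]
      by (cases s) (simp_all add: dr_gamma.abs_eq dr_c.abs_eq dr_scale.abs_eq)
  next
    case (add f g)
    then show ?case using assms(4) by (metis plus_dr.abs_eq)
  qed
  then show ?thesis by (metis Quotient3_abs_rep[OF Quotient3_dr])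
qed

lemma dr_shift_0: "dr_shift 0 = 0"
  by transfer (simp add: free_shift_def)

lemmas dr_shift_simps = dr_shift_0 dr_shift_gamma dr_shift_c dr_shift_add dr_shift_scale

lemma dr_c_add: "dr_c (a + b) = dr_c a + dr_c b + dr_scale (a * b) dr_gamma"
  using dr_relation_add[of a b] by (simp add: algebra_simps)

lemma dr_c_0: "dr_c 0 = 0"
  using dr_c_add[of 0 0] by simp

lemma dr_c_1: "dr_c 1 = 0"
  using dr_relation_mult[of 1 1] by simp

lemma dr_c_2: "dr_c 2 = dr_gamma"
  using dr_c_add[of 1 1] by (simp add: dr_c_1)

lemma dr_c_minus: "dr_c (- a) = dr_scale (a\<^sup>2) dr_gamma - dr_c a"
  using dr_c_add[of a "- a"] by (simp add: dr_c_0 power2_eq_square algebra_simps eq_neg_iff_add_eq_0)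

text \<open>Both sides are bilinear in \<open>x\<close> and \<open>y\<close>, so only pairs of
  scaled generators matter. This symmetry is what later merges the two mixed terms of a product into
  one.\<close>

lemma dr_scale_shift_commute: "dr_scale (dr_shift y) x = dr_scale (dr_shift x) y"
proof -
  \<comment> \<open>Commutativity of the base ring gives two expansions of the same symbol, one from
    \<open>a * b\<close> and one from \<open>b * a\<close>; their difference is this
    identity.\<close>
  have *: "dr_scale (b\<^sup>2 - b) (dr_c a) = dr_scale (a\<^sup>2 - a) (dr_c b)" for a b :: 'a
    using dr_relation_mult[of a b] dr_relation_mult[of b a]
    by (simp add: mult.commute dr.scale_left_diff_distrib algebra_simps)
  \<comment> \<open>The mixed pair of generators is the first defining relation. The scalars here
    and in \<open>***\<close> are grouped as \<open>dr_shift_simps\<close> leaves them in the nested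
    induction.\<close>
  have **: "dr_scale (d * 2) (dr_scale a (dr_c b)) = dr_scale (a * (b\<^sup>2 - b)) (dr_scale d dr_gamma)"
    for a b d :: 'a
  proof -
    have "dr_scale (d * 2) (dr_scale a (dr_c b)) = dr_scale (d * a) (dr_scale 2 (dr_c b))"
      by (simp add: mult_ac)
    then show ?thesis by (simp add: dr_relation_gamma [symmetric] mult_ac)
  qed
  have ***: "dr_scale (d * (e\<^sup>2 - e)) (dr_scale a (dr_c b)) =
      dr_scale (a * (b\<^sup>2 - b)) (dr_scale d (dr_c e))" for a b d e :: 'a
  proof -
    have "dr_scale (d * (e\<^sup>2 - e)) (dr_scale a (dr_c b)) = dr_scale (d * a) (dr_scale (e\<^sup>2 - e) (dr_c b))"
      by (simp only: dr.scale_scale) (simp add: mult_ac)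
    also have "\<dots> = dr_scale (d * a) (dr_scale (b\<^sup>2 - b) (dr_c e))"
      by (simp only: *)
    also have "\<dots> = dr_scale (a * (b\<^sup>2 - b)) (dr_scale d (dr_c e))"
      by (simp only: dr.scale_scale) (simp add: mult_ac)
    finally show ?thesis .
  qed
  show ?thesis
  proof (induction x rule: dr_induct)
    case zero
    then show ?case by (simp add: dr_shift_simps)
  next
    case (gamma a)
    show ?case
      by (induction y rule: dr_induct)
        (simp_all only: dr_shift_simps dr.scale_right_distrib dr.scale_left_distrib dr.scale_zero_left
          dr.scale_zero_right **, simp_all add: mult_ac)
  next
    case (c a b)
    show ?case
      by (induction y rule: dr_induct)
        (simp_all only: dr_shift_simps dr.scale_right_distrib dr.scale_left_distrib dr.scale_zero_left
          dr.scale_zero_right ** ***)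
  next
    case (add x x')
    then show ?case by (simp add: dr_shift_simps dr.scale_right_distrib dr.scale_left_distrib)
  qed
qed

lemma dr_scale_2: "dr_scale 2 x = dr_scale (dr_shift x) dr_gamma"
  using dr_scale_shift_commute[of dr_gamma x] by (simp add: dr_shift_gamma)

text \<open>The identity proved in \<open>dr_c_shift\<close> is not linear in \<open>x\<close>, so
  scaling needs an argument of its own: expand the symbol of \<open>a * dr_shift x\<close> by the
  multiplicative relation, then use the symmetry to trade \<open>dr_c a\<close> for
  \<open>x\<close>.\<close>

lemma dr_c_scale_shift:
  assumes "dr_c (dr_shift x) = dr_scale (dr_shift x - 1) x"
  shows "dr_c (dr_shift (dr_scale a x)) = dr_scale (dr_shift (dr_scale a x) - 1) (dr_scale a x)"
proof -
  let ?s = "dr_shift x"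
  have "dr_c (dr_shift (dr_scale a x)) = dr_scale a (dr_c ?s) + dr_scale (?s * ?s) (dr_c a)"
    by (simp add: dr_shift_scale dr_relation_mult flip: power2_eq_square)
  also have "\<dots> = dr_scale a (dr_scale (?s - 1) x) + dr_scale ?s (dr_scale (a\<^sup>2 - a) x)"
    using assms dr_scale_shift_commute[of x "dr_c a"] by (simp add: dr_shift_c flip: dr.scale_scale)
  also have "\<dots> = dr_scale (a * (?s - 1) + ?s * (a\<^sup>2 - a)) x"
    by (simp add: dr.scale_left_distrib)
  also have "a * (?s - 1) + ?s * (a\<^sup>2 - a) = (a * ?s - 1) * a"
    by (simp add: algebra_simps power2_eq_square)
  finally show ?thesis by (simp add: dr_shift_scale)
qed

text \<open>The left side depends on \<open>x\<close> only through its image under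
  \<open>dr_shift\<close>, so this equation limits how far that image can forget
  \<open>x\<close>.\<close>

lemma dr_c_shift: "dr_c (dr_shift x) = dr_scale (dr_shift x - 1) x"
proof (induction x rule: dr_induct)
  case zero
  then show ?case by (simp add: dr_shift_simps dr_c_0)
next
  case (gamma a)
  \<comment> \<open>At the unscaled generator the identity is
    \<open>dr_c 2 = dr_scale (2 - 1) dr_gamma\<close>.\<close>
  show ?case by (rule dr_c_scale_shift) (simp add: dr_shift_gamma dr_c_2)
next
  case (c a b)
  have "dr_c (b * b) = dr_scale (b + b\<^sup>2) (dr_c b)"
    using dr_relation_mult[of b b] by (simp add: dr.scale_left_distrib)
  moreover have "dr_c (b * b + - b) =
      dr_c (b * b) + dr_c (- b) + dr_scale (b * b * - b) dr_gamma"
    by (rule dr_c_add)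
  ultimately have "dr_c (b\<^sup>2 - b) = dr_scale (b + b\<^sup>2) (dr_c b) - dr_c b
      + (dr_scale (b\<^sup>2) dr_gamma + dr_scale (b * b * - b) dr_gamma)"
    by (simp add: dr_c_minus power2_eq_square)
  \<comment> \<open>The two multiples of \<open>dr_gamma\<close> combine to one with the factor
    \<open>b\<^sup>2 - b\<close>, which the first relation converts into a multiple of
    \<open>dr_c b\<close>.\<close>
  also have "dr_scale (b\<^sup>2) dr_gamma + dr_scale (b * b * - b) dr_gamma =
      dr_scale (- b) (dr_scale (b\<^sup>2 - b) dr_gamma)"
    by (simp add: algebra_simps power2_eq_square flip: dr.scale_left_distrib)
  also have "\<dots> = dr_scale (- b * 2) (dr_c b)"
    by (simp only: dr_relation_gamma dr.scale_scale)
  also have "dr_scale (b + b\<^sup>2) (dr_c b) - dr_c b + dr_scale (- b * 2) (dr_c b)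
      = dr_scale (b + b\<^sup>2 - 1 + - b * 2) (dr_c b)"
    by (simp only: dr.scale_left_distrib dr.scale_left_diff_distrib dr.scale_one)
  finally have "dr_c (b\<^sup>2 - b) = dr_scale (b\<^sup>2 - b - 1) (dr_c b)"
    by (simp add: algebra_simps)
  then show ?case by (intro dr_c_scale_shift) (simp add: dr_shift_c)
next
  case (add x y)
  \<comment> \<open>This is the correction term of the additive relation. It supplies exactly the
    cross terms in the expansion of
    \<open>dr_scale (dr_shift x + dr_shift y - 1) (x + y)\<close>.\<close>
  have "dr_scale (dr_shift x * dr_shift y) dr_gamma = dr_scale (dr_shift x) (dr_scale 2 y)"
    by (simp add: dr_scale_2)
  also have "\<dots> = dr_scale (dr_shift x) y + dr_scale (dr_shift y) x"
    by (simp add: dr_scale_shift_commute[of y x] mult.commute flip: dr.scale_left_distrib)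
  finally have "dr_scale (dr_shift x * dr_shift y) dr_gamma =
    dr_scale (dr_shift x) y + dr_scale (dr_shift y) x" .
  then show ?case
    unfolding dr_shift_add dr_c_add add.IH
    by (simp add: dr.scale_right_distrib dr.scale_left_distrib dr.scale_left_diff_distrib)
qed

lemma inj_dr_shift: "inj dr_shift"
proof (rule injI)
  fix x y :: "'a dr"
  assume *: "dr_shift x = dr_shift y"
  have "dr_shift (x - y) + dr_shift y = dr_shift x"
    by (simp flip: dr_shift_add)
  then have "dr_shift (x - y) = 0" using * by simp
  then have "dr_scale (- 1) (x - y) = 0"
    using dr_c_shift[of "x - y"] by (simp add: dr_c_0)
  then show "x = y" by simp
qed

text \<open>The image of a linear form is the ideal generated by its values on module generators,
  and these values are the chosen generators of \<open>I2\<close>.\<close>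

lemma range_dr_shift: "range dr_shift = (I2 :: 'a::comm_ring_1 set)"
proof
  interpret A: module "(*) :: 'a \<Rightarrow> 'a \<Rightarrow> 'a"
    by (rule module_mult)
  show "range dr_shift \<subseteq> (I2 :: 'a set)"
  proof clarify
    fix x :: "'a dr"
    have gen: "g \<in> I2" if "g \<in> insert 2 (range (\<lambda>a. a\<^sup>2 - a))" for g :: 'a
      unfolding I2_def ideal_generated_def using that by (rule A.span_base)
    have sub: "A.subspace I2" using is_ideal_I2 by (simp add: is_ideal_def)
    show "dr_shift x \<in> I2"
      by (induction x rule: dr_induct)
        (simp_all add: dr_shift_simps A.subspace_0[OF sub] A.subspace_add[OF sub]
          A.subspace_scale[OF sub] gen)
  qed
  have "A.subspace (range (dr_shift :: 'a dr \<Rightarrow> 'a))"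
    by (intro A.subspaceI) (force simp: dr_shift_simps simp flip: dr_shift_add dr_shift_scale
        intro: range_eqI[of _ _ 0] dr_shift_0[symmetric])+
  moreover have "insert 2 (range (\<lambda>a::'a. a\<^sup>2 - a)) \<subseteq> range dr_shift"
    by (auto simp flip: dr_shift_gamma dr_shift_c)
  ultimately show "(I2 :: 'a set) \<subseteq> range dr_shift"
    unfolding I2_def ideal_generated_def by (intro A.span_minimal)
qed

section \<open>Change of variables and functoriality of symmetric algebras\<close>

text \<open>Being an evaluation with values in another polynomial ring, it inherits the homomorphism
  laws of \<open>mpol_eval\<close>.\<close>

definition mpol_map :: "('x \<Rightarrow> 'y) \<Rightarrow> ('x, 'a::comm_ring_1) mpol \<Rightarrow> ('y, 'a) mpol" where
  "mpol_map g = mpol_eval mConst (\<lambda>x. mVar (g x))"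

lemma is_ring_hom_mConst: "is_ring_hom (mConst :: 'a::comm_ring_1 \<Rightarrow> ('x, 'a) mpol)"
  by (simp add: is_ring_hom_def mConst_def single_add mult_single)

lemma is_ring_hom_mpol_map: "is_ring_hom (mpol_map g)"
  unfolding mpol_map_def by (rule is_ring_hom_mpol_eval[OF is_ring_hom_mConst])

lemma mpol_map_const: "mpol_map g (mConst a) = mConst a"
  by (simp add: mpol_map_def mpol_eval_const is_ring_hom_mConst)

lemma mpol_map_var: "mpol_map g (mVar x) = mVar (g x)"
  by (simp add: mpol_map_def mpol_eval_var is_ring_hom_mConst)

lemma mpol_eval_cong:
  assumes "p \<in> polys_over M" "\<And>x. x \<in> M \<Longrightarrow> g x = g' x"
  shows "mpol_eval h g p = mpol_eval h g' p"
proof -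
  have "mon_eval g m = mon_eval g' m" if "m \<in> Poly_Mapping.keys p" for m
    unfolding mon_eval_def using that assms unfolding polys_over_def
    by (intro prod.cong arg_cong2[of _ _ _ _ "(^)"]) auto
  then show ?thesis unfolding mpol_eval_def by (intro sum.cong) auto
qed

lemma is_ring_hom_mon_eval:
  assumes "is_ring_hom f" shows "f (mon_eval g m) = mon_eval (\<lambda>x. f (g x)) m"
proof -
  note f = is_ring_homD[OF assms]
  have pow: "f (a ^ n) = f a ^ n" for a n by (induction n) (simp_all add: f)
  have "f (\<Prod>x\<in>B. g x ^ Poly_Mapping.lookup m x) = (\<Prod>x\<in>B. f (g x) ^ Poly_Mapping.lookup m x)"
    if "finite B" for B
    using that by induction (simp_all add: f pow)
  then show ?thesis by (simp add: mon_eval_def)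
qed

lemma is_ring_hom_mpol_eval_comp:
  assumes f: "is_ring_hom f" and h: "is_ring_hom h"
  shows "f (mpol_eval h g p) = mpol_eval (\<lambda>a. f (h a)) (\<lambda>x. f (g x)) p"
proof -
  have fh: "is_ring_hom (\<lambda>a. f (h a))"
    using is_ring_homD[OF f] is_ring_homD[OF h] by (simp add: is_ring_hom_def)
  show ?thesis
    by (induction p rule: mpol_induct)
      (simp_all add: mpol_eval_single mpol_eval_add fh h is_ring_homD[OF f] is_ring_hom_mon_eval[OF f])
qed

lemma mpol_eval_mpol_map:
  assumes "is_ring_hom h"
  shows "mpol_eval h g (mpol_map g' p) = mpol_eval h (\<lambda>x. g (g' x)) p"
  unfolding mpol_map_def
  by (simp add: is_ring_hom_mpol_eval_comp is_ring_hom_mpol_eval assms is_ring_hom_mConst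
      mpol_eval_const mpol_eval_var)

lemma mon_eval_mVar: "mon_eval (mVar :: 'x \<Rightarrow> ('x, 'a::comm_ring_1) mpol) m = Poly_Mapping.single m 1"
proof -
  have pow: "(mVar x :: ('x, 'a) mpol) ^ n = Poly_Mapping.single (Poly_Mapping.single x n) 1" for x n
    by (induction n) (simp_all add: mVar_def mult_single flip: single_add)
  have prod: "(\<Prod>x\<in>B. (mVar x :: ('x, 'a) mpol) ^ f x) =
      Poly_Mapping.single (\<Sum>x\<in>B. Poly_Mapping.single x (f x)) 1" if "finite B" for B f
    using that by induction (simp_all add: pow mult_single)
  have "m = (\<Sum>x\<in>Poly_Mapping.keys m. Poly_Mapping.single x (Poly_Mapping.lookup m x))"
    by (rule poly_mapping_eqI) (auto simp: lookup_sum lookup_single when_def in_keys_iff)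
  then show ?thesis by (simp add: mon_eval_def prod)
qed

lemma mpol_eval_mVar: "mpol_eval mConst mVar p = p"
proof (induction p rule: mpol_induct)
  case (single m a)
  show ?case
    by (simp add: mpol_eval_single[OF is_ring_hom_mConst] mon_eval_mVar)
      (simp add: mConst_def mult_single)
qed (simp_all add: mpol_eval_add[OF is_ring_hom_mConst])

text \<open>The inverse law is asked for on \<open>M\<close> only, since the map inverse to
  \<open>dr_shift\<close> is controlled only on \<open>I2\<close>.\<close>

lemma mpol_map_inverse:
  assumes "p \<in> polys_over M" "\<And>x. x \<in> M \<Longrightarrow> g' (g x) = x"
  shows "mpol_map g' (mpol_map g p) = p"
proof -
  have "mpol_map g' (mpol_map g p) = mpol_eval mConst (\<lambda>x. mVar (g' (g x))) p"
    unfolding mpol_map_def[of g']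
    by (simp add: mpol_eval_mpol_map is_ring_hom_mConst)
  also have "\<dots> = mpol_eval mConst mVar p"
    by (rule mpol_eval_cong[OF assms(1)]) (simp add: assms(2))
  finally show ?thesis by (simp add: mpol_eval_mVar)
qed

lemma mConst_in_polys_over: "mConst a \<in> polys_over M"
  by (simp add: polys_over_def mConst_def)

lemma mVar_in_polys_over: "x \<in> M \<Longrightarrow> mVar x \<in> polys_over M"
  by (simp add: polys_over_def mVar_def)

lemma mpol_map_in_polys_over:
  fixes p :: "('x, 'a::comm_ring_1) mpol" and g :: "'x \<Rightarrow> 'y"
  assumes "p \<in> polys_over M" "\<And>x. x \<in> M \<Longrightarrow> g x \<in> N"
  shows "mpol_map g p \<in> polys_over N"
proof -
  have one: "1 \<in> polys_over N" by (simp add: polys_over_def)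
  have pow: "q ^ n \<in> polys_over N" if "q \<in> polys_over N" for q :: "('y, 'a) mpol" and n
    by (induction n) (simp_all add: one that mult_in_polys_over)
  have prod: "(\<Prod>x\<in>B. f x) \<in> polys_over N" if "finite B" "\<forall>x\<in>B. f x \<in> polys_over N"
    for B and f :: "'x \<Rightarrow> ('y, 'a) mpol"
    using that by induction (simp_all add: one mult_in_polys_over)
  have sum: "(\<Sum>m\<in>B. f m) \<in> polys_over N" if "finite B" "\<forall>m\<in>B. f m \<in> polys_over N"
    for B and f :: "('x \<Rightarrow>\<^sub>0 nat) \<Rightarrow> ('y, 'a) mpol"
    using that by induction (simp_all add: zero_in_polys_over add_in_polys_over)
  show ?thesis
    unfolding mpol_map_def mpol_eval_def mon_eval_def using assms
    by (auto intro!: sum prod mult_in_polys_over mConst_in_polys_over pow mVar_in_polys_over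
        simp: polys_over_def[of M])
qed

text \<open>A map that is linear on \<open>M\<close> sends relators to relators, and the
  coefficients stay polynomials over \<open>N\<close>. Hence a linear map of modules induces a map
  of symmetric algebras.\<close>

lemma mpol_map_sym_ideal:
  assumes "p \<in> sym_ideal scale M"
    and N: "\<And>x. x \<in> M \<Longrightarrow> g x \<in> N"
    and add: "\<And>x y. x \<in> M \<Longrightarrow> y \<in> M \<Longrightarrow> g (x + y) = g x + g y"
    and scale: "\<And>a x. x \<in> M \<Longrightarrow> g (scale a x) = scale' a (g x)"
  shows "mpol_map g p \<in> sym_ideal scale' N"
proof -
  note hom = is_ring_homD[OF is_ring_hom_mpol_map]
  from assms(1) obtain q T where p: "p = (\<Sum>r\<in>T. q r * r)" "finite T" "T \<subseteq> sym_relators scale M"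
    "\<forall>r\<in>T. q r \<in> polys_over M"
    by (auto simp: sym_ideal_def)
  have "mpol_map g r \<in> sym_ideal scale' N" if "r \<in> sym_relators scale M" for r
  proof -
    have "mpol_map g r \<in> sym_relators scale' N"
      using that N unfolding sym_relators_def
      by (elim UnE CollectE exE conjE, hypsubst)
        (simp_all only: hom mpol_map_var mpol_map_const add scale, blast+)
    then show ?thesis by (rule sym_relators_in_sym_ideal)
  qed
  with p(2-4) have "mpol_map g (\<Sum>r\<in>T. q r * r) \<in> sym_ideal scale' N"
    by induction
      (auto simp: hom zero_in_sym_ideal intro!: sym_ideal_add sym_ideal_mult
        mpol_map_in_polys_over[OF _ N])
  then show ?thesis by (simp add: p)
qed

section \<open>Homogeneous polynomials of degree two\<close>

lemma mon_degree_add: "mon_degree (m + n) = mon_degree m + mon_degree n"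
proof -
  let ?A = "Poly_Mapping.keys m \<union> Poly_Mapping.keys n"
  have "mon_degree k = (\<Sum>x\<in>?A. Poly_Mapping.lookup k x)" if "k \<in> {m, n, m + n}" for k
    unfolding mon_degree_def
    by (rule sum.mono_neutral_left) (use that keys_add[of m n] in \<open>auto simp: in_keys_iff lookup_add\<close>)
  then show ?thesis by (simp add: lookup_add sum.distrib)
qed

lemma mon_degree_single: "mon_degree (Poly_Mapping.single x n) = n"
  by (simp add: mon_degree_def)

lemma mon_degree_SucE:
  assumes "mon_degree m = Suc n"
  obtains x m' where "m = Poly_Mapping.single x 1 + m'" "mon_degree m' = n"
proof -
  have "Poly_Mapping.keys m \<noteq> {}" using assms by (auto simp: mon_degree_def)
  then obtain x where x: "x \<in> Poly_Mapping.keys m" by blast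
  \<comment> \<open>Subtraction of exponents is truncated; it is undone by the addition because
    \<open>x\<close> has a positive exponent in \<open>m\<close>.\<close>
  have m: "m = Poly_Mapping.single x 1 + (m - Poly_Mapping.single x 1)"
    using x by (intro poly_mapping_eqI)
      (auto simp: lookup_add lookup_minus lookup_single when_def in_keys_iff)
  have "mon_degree m = 1 + mon_degree (m - Poly_Mapping.single x 1)"
    by (subst m, subst mon_degree_add) (simp add: mon_degree_single)
  with that m assms show ?thesis by simp
qed

lemma mon_degree_2E:
  assumes "mon_degree m = 2"
  obtains x y where "m = Poly_Mapping.single x 1 + Poly_Mapping.single y 1"
proof -
  from assms have "mon_degree m = Suc (Suc 0)" by simp
  then obtain x m' where m: "m = Poly_Mapping.single x 1 + m'" "mon_degree m' = Suc 0"
    by (rule mon_degree_SucE)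
  from m(2) obtain y m'' where m': "m' = Poly_Mapping.single y 1 + m''" "mon_degree m'' = 0"
    by (rule mon_degree_SucE)
  from m'(2) have "m'' = 0" by (auto simp: mon_degree_def in_keys_iff intro!: poly_mapping_eqI)
  with m m' that show ?thesis by simp
qed

text \<open>Each monomial of degree two is a product of two variables, possibly equal, so additive
  statements need only be checked on such products.\<close>

lemma homogeneous_2_induct [consumes 1, case_names zero monomial add]:
  fixes p :: "('x, 'a::comm_ring_1) mpol"
  assumes "homogeneous 2 p" "P 0" "\<And>a x y. P (mConst a * (mVar x * mVar y))"
    and "\<And>p q. P p \<Longrightarrow> P q \<Longrightarrow> P (p + q)"
  shows "P p"
proof -
  have mon: "P (Poly_Mapping.single m a)" if m: "mon_degree m = 2" for m a
  proof -
    obtain x y where "m = Poly_Mapping.single x 1 + Poly_Mapping.single y 1"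
      using m by (rule mon_degree_2E)
    then show ?thesis using assms(3)[of a x y] by (simp add: mConst_def mVar_def mult_single)
  qed
  have "P (\<Sum>m\<in>B. Poly_Mapping.single m (Poly_Mapping.lookup p m))"
    if "finite B" "\<forall>m\<in>B. mon_degree m = 2" for B
    using that by induction (auto intro: assms mon)
  moreover have "p = (\<Sum>m\<in>Poly_Mapping.keys p. Poly_Mapping.single m (Poly_Mapping.lookup p m))"
    by (rule poly_mapping_eqI) (auto simp: lookup_sum lookup_single when_def in_keys_iff)
  ultimately show ?thesis using assms(1) by (metis finite_keys homogeneous_def)
qed

lemma homogeneous_0: "homogeneous n 0"
  by (simp add: homogeneous_def)

lemma homogeneous_add: "homogeneous n p \<Longrightarrow> homogeneous n q \<Longrightarrow> homogeneous n (p + q)"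
  unfolding homogeneous_def using keys_add[of p q] by blast

lemma homogeneous_uminus:
  fixes p :: "('x, 'a::ab_group_add) mpol"
  shows "homogeneous n p \<Longrightarrow> homogeneous n (- p)"
  by (simp add: homogeneous_def in_keys_iff)

lemma homogeneous_mpol_map: "homogeneous 2 p \<Longrightarrow> homogeneous 2 (mpol_map g p)"
proof (induction p rule: homogeneous_2_induct)
  case (monomial a x y)
  then show ?case
    by (simp add: is_ring_homD[OF is_ring_hom_mpol_map] mpol_map_const mpol_map_var)
      (auto simp: mConst_def mVar_def mult_single homogeneous_def mon_degree_add mon_degree_single)
qed (simp_all add: is_ring_homD[OF is_ring_hom_mpol_map] homogeneous_0 homogeneous_add)

section \<open>Injectivity on the symmetric square as a kernel condition\<close>

lemma sym_class_eq_iff: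
  assumes "p \<in> polys_over M" "q \<in> polys_over M"
  shows "sym_class scale M p = sym_class scale M q \<longleftrightarrow> p - q \<in> sym_ideal scale M"
proof
  assume "sym_class scale M p = sym_class scale M q"
  moreover have "p \<in> sym_class scale M p"
    using assms by (simp add: sym_class_def zero_in_sym_ideal)
  ultimately show "p - q \<in> sym_ideal scale M" by (simp add: sym_class_def)
next
  assume pq: "p - q \<in> sym_ideal scale M"
  have "r - p \<in> sym_ideal scale M \<longleftrightarrow> r - q \<in> sym_ideal scale M" for r
    using sym_ideal_add[OF _ pq, of "r - p"]
      sym_ideal_add[OF _ sym_ideal_uminus[OF pq], of "r - q"] by auto
  then show "sym_class scale M p = sym_class scale M q" by (simp add: sym_class_def)
qed

text \<open>Evaluation is additive and homogeneous polynomials are closed under differences, so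
  injectivity on classes becomes triviality of the kernel, expressed by representatives
  alone.\<close>

lemma syzygetic_iff:
  "syzygetic I \<longleftrightarrow> (\<forall>p\<in>polys_over I. homogeneous 2 p \<longrightarrow> mpol_eval (\<lambda>a. a) (\<lambda>x. x) p = 0 \<longrightarrow>
     p \<in> sym_ideal (*) I)"
  (is "_ \<longleftrightarrow> ?R")
proof -
  note hom = is_ring_homD[OF is_ring_hom_mpol_eval[OF is_ring_hom_id, of "\<lambda>x. x"]]
  let ?e = "mpol_eval (\<lambda>a. a) (\<lambda>x. x)"
  have "syzygetic I \<longleftrightarrow> (\<forall>p\<in>polys_over I. homogeneous 2 p \<longrightarrow>
      (\<forall>q\<in>polys_over I. homogeneous 2 q \<longrightarrow> ?e p = ?e q \<longrightarrow> p - q \<in> sym_ideal (*) I))"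
    unfolding syzygetic_def sym_power_def inj_on_def
    by (auto simp: sym_mult_map_class sym_class_eq_iff)
  also have "\<dots> \<longleftrightarrow> ?R"
  proof (intro iffI ballI impI)
    fix p
    assume "\<forall>p\<in>polys_over I. homogeneous 2 p \<longrightarrow>
      (\<forall>q\<in>polys_over I. homogeneous 2 q \<longrightarrow> ?e p = ?e q \<longrightarrow> p - q \<in> sym_ideal (*) I)"
      "p \<in> polys_over I" "homogeneous 2 p" "?e p = 0"
    then have "p - 0 \<in> sym_ideal (*) I"
      using zero_in_polys_over homogeneous_0 mpol_eval_0 by metis
    then show "p \<in> sym_ideal (*) I" by simp
  next
    fix p q
    assume *: ?R and pq: "p \<in> polys_over I" "homogeneous 2 p" "q \<in> polys_over I" "homogeneous 2 q"
      "?e p = ?e q"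
    have "p + - q \<in> polys_over I" "homogeneous 2 (p + - q)"
      using pq(1-4) by (simp_all only: add_in_polys_over uminus_in_polys_over homogeneous_add homogeneous_uminus)
    moreover have "?e (p + - q) = 0"
      using pq(5) by (simp only: hom) simp
    ultimately have "p + - q \<in> sym_ideal (*) I" using * by blast
    then show "p - q \<in> sym_ideal (*) I" by simp
  qed
  finally show ?thesis .
qed

section \<open>The kernel of the first cobar differential in internal degree 4\<close>

text \<open>The augmentation sending every variable to 0 kills the symmetric ideal and fixes
  constants.\<close>

lemma bud_const_eq_0D: "bud_const a = 0 \<Longrightarrow> a = 0"
proof -
  assume "bud_const a = 0"
  then have "mConst a \<in> sym_ideal dr_scale UNIV"
    by (simp add: bud_const.abs_eq zero_bud_ring.abs_eq bud_ring.abs_eq_iff bud_cong_def)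
  from sym_ideal_mpol_eval[OF is_ring_hom_id _ _ this, of "\<lambda>_. 0"]
  show "a = 0" by (simp add: mpol_eval_const is_ring_hom_id)
qed

text \<open>Internal degree 4 is polynomial degree 2. Both sides are additive in \<open>p\<close>,
  so products of two variables suffice. The listed coefficients are those of \<open>1\<close>,
  \<open>t\<close> and \<open>t^2\<close>.\<close>

lemma cobar_d0_degree_4:
  assumes "homogeneous 2 p"
  shows "cobar_d0 (abs_bud_ring p) =
    [:0, bud_const (mpol_eval (\<lambda>a. a) dr_shift p) * bud_of_dr dr_gamma,
      bud_const (mpol_eval (\<lambda>a. a) dr_shift p):]"
  using assms
proof (induction p rule: homogeneous_2_induct)
  case zero
  have "eta_R (0 :: 'a bud_ring) = 0" by (rule is_ring_homD(1)[OF is_ring_hom_eta_R])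
  then show ?case
    by (simp add: cobar_d0_def eta_L_def is_ring_homD[OF is_ring_hom_bud_const] flip: zero_bud_ring.abs_eq)
next
  case (monomial a x y)
  let ?s = "dr_shift x * dr_shift y"
  have abs: "abs_bud_ring (mConst a * (mVar x * mVar y)) = bud_const a * (bud_of_dr x * bud_of_dr y)"
    by (simp add: bud_const.abs_eq bud_of_dr_def times_bud_ring.abs_eq)
  \<comment> \<open>The coefficient of \<open>t\<close> is simplified inside the module of
    generators, where the symmetry is available, and then carried to the bud ring.\<close>
  have "dr_scale (dr_shift y) x + dr_scale (dr_shift x) y = dr_scale (dr_shift x) (dr_scale 2 y)"
    by (simp add: dr_scale_shift_commute[of y x] mult.commute flip: dr.scale_left_distrib)
  also have "\<dots> = dr_scale ?s dr_gamma" by (simp add: dr_scale_2)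
  finally have "bud_of_dr (dr_scale (dr_shift y) x + dr_scale (dr_shift x) y) =
      bud_of_dr (dr_scale ?s dr_gamma)" by simp
  then have *: "bud_const (dr_shift y) * bud_of_dr x + bud_const (dr_shift x) * bud_of_dr y =
      bud_const ?s * bud_of_dr dr_gamma"
    by (simp add: bud_of_dr_add bud_of_dr_scale)
  have "mpol_eval (\<lambda>a. a) dr_shift (mConst a * (mVar x * mVar y)) = a * ?s"
    by (simp add: is_ring_homD[OF is_ring_hom_mpol_eval[OF is_ring_hom_id]] mpol_eval_const mpol_eval_var
        is_ring_hom_id)
  then show ?case
    unfolding abs using *
    by (simp add: cobar_d0_def eta_L_def is_ring_homD[OF is_ring_hom_eta_R] eta_R_const eta_R_of_dr
        is_ring_homD[OF is_ring_hom_bud_const] mult_ac add_ac flip: distrib_left)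
next
  case (add p q)
  have "cobar_d0 (abs_bud_ring (p + q)) = cobar_d0 (abs_bud_ring p) + cobar_d0 (abs_bud_ring q)"
    by (simp add: cobar_d0_def eta_L_def is_ring_homD[OF is_ring_hom_eta_R] flip: plus_bud_ring.abs_eq)
  then show ?case
    by (simp add: add is_ring_homD[OF is_ring_hom_bud_const] mpol_eval_add[OF is_ring_hom_id] algebra_simps)
qed

lemma H0_fl_buds_2_eq_0_iff:
  "(H0_fl_buds 2 :: 'a::comm_ring_1 bud_ring set) = {0} \<longleftrightarrow>
    (\<forall>p :: ('a dr, 'a) mpol. homogeneous 2 p \<longrightarrow> mpol_eval (\<lambda>a. a) dr_shift p = 0 \<longrightarrow>
      p \<in> sym_ideal dr_scale UNIV)"
proof -
  have deg: "(\<forall>m\<in>Poly_Mapping.keys p. 2 * mon_degree m = 2 * 2) \<longleftrightarrow> homogeneous 2 p"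
    for p :: "('a dr, 'a) mpol"
    by (auto simp: homogeneous_def)
  \<comment> \<open>The top coefficient is the evaluated constant itself, so the differential
    vanishes only if that constant does.\<close>
  have ker: "cobar_d0 (abs_bud_ring p) = 0 \<longleftrightarrow> mpol_eval (\<lambda>a. a) dr_shift p = 0"
    if "homogeneous 2 p" for p :: "('a dr, 'a) mpol"
    using bud_const_eq_0D by (auto simp: cobar_d0_degree_4[OF that] is_ring_homD[OF is_ring_hom_bud_const])
  have zero: "abs_bud_ring p = 0 \<longleftrightarrow> p \<in> sym_ideal dr_scale UNIV" for p :: "('a dr, 'a) mpol"
    by (simp add: zero_bud_ring.abs_eq bud_ring.abs_eq_iff bud_cong_def)
  have H0: "H0_fl_buds 2 =
      abs_bud_ring ` {p :: ('a dr, 'a) mpol. homogeneous 2 p \<and> mpol_eval (\<lambda>a. a) dr_shift p = 0}"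
    unfolding H0_fl_buds_def bud_degree_part_def deg using ker by auto
  have "0 \<in> (H0_fl_buds 2 :: 'a bud_ring set)"
    unfolding H0 by (rule image_eqI[of _ _ 0]) (simp_all add: zero_bud_ring.abs_eq homogeneous_0)
  then have "H0_fl_buds 2 = {0 :: 'a bud_ring} \<longleftrightarrow> (\<forall>x\<in>H0_fl_buds 2. x = (0 :: 'a bud_ring))"
    by blast
  then show ?thesis unfolding H0 by (auto simp: zero)
qed

section \<open>Transport of the kernel condition along the isomorphism with
  \<open>I2\<close>\<close>

lemma H0_fl_buds_2_iff_syzygetic:
  "(H0_fl_buds 2 :: 'a::comm_ring_1 bud_ring set) = {0} \<longleftrightarrow> syzygetic (I2 :: 'a set)"
proof -
  \<comment> \<open>Outside \<open>I2\<close> nothing is known about the values of \<open>u\<close>,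
    so its inverse law and linearity are stated for elements of \<open>I2\<close>.\<close>
  define u where "u = inv (dr_shift :: 'a dr \<Rightarrow> 'a)"
  have us: "u (dr_shift x) = x" for x unfolding u_def by (simp add: inj_dr_shift)
  have su: "dr_shift (u a) = a" if "a \<in> I2" for a
    unfolding u_def using that by (simp add: f_inv_into_f flip: range_dr_shift)
  have I2: "a \<in> I2 \<Longrightarrow> b \<in> I2 \<Longrightarrow> a + b \<in> I2" "a \<in> I2 \<Longrightarrow> c * a \<in> I2" for a b c :: 'a
    using is_ideal_I2 module.subspace_add[OF module_mult] module.subspace_scale[OF module_mult]
    unfolding is_ideal_def by blast+
  have shift: "dr_shift x \<in> I2" for x :: "'a dr"
    using range_dr_shift by blast
  have u_add: "u (a + b) = u a + u b" if "a \<in> I2" "b \<in> I2" for a b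
    by (rule injD[OF inj_dr_shift]) (simp add: that su I2 dr_shift_add)
  have u_scale: "u (c * a) = dr_scale c (u a)" if "a \<in> I2" for a c
    by (rule injD[OF inj_dr_shift]) (simp add: that su I2 dr_shift_scale)
  show ?thesis
    unfolding H0_fl_buds_2_eq_0_iff syzygetic_iff
  proof (intro iffI allI ballI impI)
    fix p :: "('a, 'a) mpol"
    assume H: "\<forall>p :: ('a dr, 'a) mpol. homogeneous 2 p \<longrightarrow> mpol_eval (\<lambda>a. a) dr_shift p = 0 \<longrightarrow>
        p \<in> sym_ideal dr_scale UNIV"
      and p: "p \<in> polys_over I2" "homogeneous 2 p" "mpol_eval (\<lambda>a. a) (\<lambda>x. x) p = 0"
    \<comment> \<open>Renaming variables along \<open>u\<close> matches the two evaluations.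
      Renaming back along \<open>dr_shift\<close> then returns \<open>p\<close> itself, not merely a
      polynomial congruent to it.\<close>
    have "mpol_eval (\<lambda>a. a) dr_shift (mpol_map u p) = mpol_eval (\<lambda>a. a) (\<lambda>x. x) p"
      unfolding mpol_eval_mpol_map[OF is_ring_hom_id] by (rule mpol_eval_cong[OF p(1) su])
    then have "mpol_map u p \<in> sym_ideal dr_scale UNIV"
      using H p homogeneous_mpol_map by metis
    then have "mpol_map dr_shift (mpol_map u p) \<in> sym_ideal (*) I2"
      by (rule mpol_map_sym_ideal) (simp_all add: shift dr_shift_add dr_shift_scale)
    then show "p \<in> sym_ideal (*) I2"
      using mpol_map_inverse[of p I2 dr_shift u] p(1) su by simp
  next
    fix p :: "('a dr, 'a) mpol"
    assume H: "\<forall>p\<in>polys_over (I2 :: 'a set). homogeneous 2 p \<longrightarrow>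
        mpol_eval (\<lambda>a. a) (\<lambda>x. x) p = 0 \<longrightarrow> p \<in> sym_ideal (*) I2"
      and p: "homogeneous 2 p" "mpol_eval (\<lambda>a. a) dr_shift p = 0"
    have "mpol_map dr_shift p \<in> polys_over I2"
      by (rule mpol_map_in_polys_over[of _ UNIV]) (simp_all add: shift)
    moreover have "mpol_eval (\<lambda>a. a) (\<lambda>x. x) (mpol_map dr_shift p) = 0"
      using p by (simp add: mpol_eval_mpol_map[OF is_ring_hom_id])
    ultimately have "mpol_map dr_shift p \<in> sym_ideal (*) I2"
      using H p homogeneous_mpol_map by blast
    then have "mpol_map u (mpol_map dr_shift p) \<in> sym_ideal dr_scale UNIV"
      by (rule mpol_map_sym_ideal) (simp_all add: u_add u_scale)
    then show "p \<in> sym_ideal dr_scale UNIV"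
      using mpol_map_inverse[of p UNIV u dr_shift] us by simp
  qed
qed

theorem corollary3p7:
  assumes "noetherian TYPE('a::{idom, ring_char_0})"
  shows "(H0_fl_buds 2 :: 'a bud_ring set) = {0} \<longleftrightarrow> syzygetic (I2 :: 'a set)"
  by (rule H0_fl_buds_2_iff_syzygetic)

end
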